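(* For every integer $\ell\ge1$, the proportionality degree of Reverse Sequential PAV at level $\ell$ is exactly $0$, i.e., $d_{\mathrm{RevSeqPAV}}(\ell)=0$.
   Context: An election is a tuple $E=(N,C,A,k)$, where $N=\{1,\ldots,n\}$ is a set of voters, $C$ is a set of $m$ candidates, $A=(A_i)_{i\in N}$ is a profile of approval ballots $A_i\subseteq C$, and $k$ is the desired committee size. It is assumed that $1\le k<m$ and that $A_i\ne\emptyset$ for at least one voter $i$. A committee is a set $W\subseteq C$ with $|W|=k$. A voting rule $\mathcal R$ maps each election $E$ to a committee $\mathcal R(E)$. For an integer $t\ge 0$, $H(t)=\sum_{j=1}^{t}1/j$ (so $H(0)=0$). For $S\subseteq C$, $\operatorname{PAV}(S)=\sum_{i\in N}H(|A_i\cap S|)$, and for $c\in S$ the marginal loss is $\Delta_S(c)=\operatorname{PAV}(S)-\operatorname{PAV}(S\setminus\{c\})$. Reverse Sequential PAV (RevSeqPAV): let $C_m=C$; for $s=m,m-1,\ldots,k+1$ pick $c_s\in\arg\min_{c\in C_s}\Delta_{C_s}(c)$ and set $C_{s-1}=C_s\setminus\{c_s\}$; return $W=C_k$. Ties are resolved using a fixed priority (linear) order on candidates. For an integer $\ell\ge1$, a group of voters $V\subseteq N$ is $\ell$-cohesive if $|V|\ge \ell n/k$ and $|\bigcap_{i\in V}A_i|\ge \ell$. For a non-empty group $V\subseteq N$ and a committee $W$, $\operatorname{avg}_V(W)=\frac{1}{|V|}\sum_{i\in V}|A_i\cap W|$. A rule $\mathcal R$ has proportionality degree at least $d$ at level $\ell$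 if for every election $E$ and every $\ell$-cohesive group $V$ in $E$, $\operatorname{avg}_V(\mathcal R(E))\ge d$. The proportionality degree $d_{\mathcal R}(\ell)$ of $\mathcal R$ at level $\ell$ is the largest $d$ for which this guarantee holds. *)

theory Defs
  imports "HOL-Analysis.Harmonic_Numbers"
begin

record 'c election =
  num_voters :: nat
  candidates :: "'c set"
  ballot :: "nat \<Rightarrow> 'c set"
  committee_size :: nat

definition voters :: "'c election \<Rightarrow> nat set" where
  "voters E = {1..num_voters E}"

text \<open>
  The record type also contains ill-formed tuples, so the standing assumptions on elections are
  collected in a predicate. Values of \<^const>\<open>ballot\<close> outside the set of voters are irrelevant.
\<close>

definition valid_election :: "'c election \<Rightarrow> bool" where
  "valid_election E \<longleftrightarrow>
     finite (candidates E) \<and>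
     (\<forall>i\<in>voters E. ballot E i \<subseteq> candidates E) \<and>
     1 \<le> committee_size E \<and> committee_size E < card (candidates E) \<and>
     (\<exists>i\<in>voters E. ballot E i \<noteq> {})"

definition PAV :: "'c election \<Rightarrow> 'c set \<Rightarrow> real" where
  "PAV E S = (\<Sum>i\<in>voters E. harm (card (ballot E i \<inter> S)))"

definition marginal_loss :: "'c election \<Rightarrow> 'c set \<Rightarrow> 'c \<Rightarrow> real" where
  "marginal_loss E S c = PAV E S - PAV E (S - {c})"

definition min_loss_candidates :: "'c election \<Rightarrow> 'c set \<Rightarrow> 'c set" where
  "min_loss_candidates E S = {c. is_arg_min (marginal_loss E S) (\<lambda>c. c \<in> S) c}"

text \<open>
  The relation \<open>r\<close> is the priority order: \<open>(c, d) \<in> r\<close> means that \<open>c\<close> has at most the priority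
  of \<open>d\<close>. Among tied candidates, the one of lowest priority is removed.
\<close>

definition removed_candidate :: "'c rel \<Rightarrow> 'c election \<Rightarrow> 'c set \<Rightarrow> 'c" where
  "removed_candidate r E S =
     (THE c. c \<in> min_loss_candidates E S \<and> (\<forall>d\<in>min_loss_candidates E S. (c, d) \<in> r))"

definition RevSeqPAV :: "'c rel \<Rightarrow> 'c election \<Rightarrow> 'c set" where
  "RevSeqPAV r E =
     ((\<lambda>S. S - {removed_candidate r E S}) ^^ (card (candidates E) - committee_size E))
       (candidates E)"

text \<open>For the empty group the intersection below is \<^const>\<open>UNIV\<close>, but in a valid election
  with \<open>l \<ge> 1\<close> the size bound already excludes empty groups.\<close>

definition cohesive :: "'c election \<Rightarrow> nat \<Rightarrow> nat set \<Rightarrow> bool" where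
  "cohesive E l V \<longleftrightarrow>
     V \<subseteq> voters E \<and>
     real (card V) \<ge> real l * real (num_voters E) / real (committee_size E) \<and>
     card (\<Inter>i\<in>V. ballot E i) \<ge> l"

definition avg_satisfaction :: "'c election \<Rightarrow> nat set \<Rightarrow> 'c set \<Rightarrow> real" where
  "avg_satisfaction E V W = (\<Sum>i\<in>V. real (card (ballot E i \<inter> W))) / real (card V)"

definition proportionality_degree_at_least ::
  "('c election \<Rightarrow> 'c set) \<Rightarrow> nat \<Rightarrow> real \<Rightarrow> bool" where
  "proportionality_degree_at_least R l d \<longleftrightarrow>
     (\<forall>E V. valid_election E \<and> cohesive E l V \<longrightarrow> avg_satisfaction E V (R E) \<ge> d)"

text \<open>A relation rather than a function, so that existence of the maximum is part of the claim.\<close>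

definition is_proportionality_degree ::
  "('c election \<Rightarrow> 'c set) \<Rightarrow> nat \<Rightarrow> real \<Rightarrow> bool" where
  "is_proportionality_degree R l d \<longleftrightarrow>
     proportionality_degree_at_least R l d \<and>
     (\<forall>d'. proportionality_degree_at_least R l d' \<longrightarrow> d' \<le> d)"

end

theory Submission
  imports Defs
begin

text \<open>
  With \<open>B = 4 l\<close> and \<open>k = 10 l\<^sup>2\<close>, take disjoint candidate sets \<open>C\<close> of size \<open>l\<close> and
  \<open>X 0, \<dots>, X B\<close> of size \<open>k\<close>, and three kinds of voters: for each \<open>1 \<le> i \<le> B\<close> one voter
  approving \<open>C \<union> X i\<close>, then \<open>B\<^sup>2\<close> voters approving \<open>X 0 \<union> \<dots> \<union> X B\<close>, and two voters for each
  member of \<open>X 0\<close> approving only that candidate. The first \<open>B\<close> voters are \<open>l\<close>-cohesive because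
  of \<open>C\<close>. As long as some candidate of \<open>C\<close> remains, the second group makes every other candidate
  costlier to remove, since \<open>(B - 1) / (k + 1) < B\<^sup>2 / (k (B + 1))\<close>. Afterwards a candidate of
  \<open>X i\<close> with \<open>i \<ge> 1\<close> loses at most \<open>1\<close> besides the contribution of the second group, whereas a
  candidate of \<open>X 0\<close> loses at least \<open>2\<close> besides that same contribution. So the committee is
  \<open>X 0\<close>, which no voter of the cohesive group approves.
\<close>

section \<open>Tie-breaking and marginal losses in an arbitrary election\<close>

lemma linear_order_finite_has_least:
  assumes "linear_order r" "finite A" "A \<noteq> {}"
  shows "\<exists>c\<in>A. \<forall>d\<in>A. (c, d) \<in> r"
  using assms(2,3)
proof (induction A rule: finite_ne_induct)
  case (singleton x)
  then show ?case
    using assms(1) by (auto simp: order_on_defs dest: refl_onD)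
next
  case (insert x F)
  then obtain c where c: "c \<in> F" "\<forall>d\<in>F. (c, d) \<in> r" by blast
  have rfl: "(y, y) \<in> r" for y
    using assms(1) by (auto simp: order_on_defs dest: refl_onD)
  have tr: "trans r"
    using assms(1) by (simp add: order_on_defs)
  have "(c, x) \<in> r \<or> (x, c) \<in> r"
    using assms(1) rfl by (cases "c = x") (auto simp: order_on_defs total_on_def)
  then show ?case
  proof
    assume "(c, x) \<in> r"
    with c show ?thesis by blast
  next
    assume "(x, c) \<in> r"
    with c rfl have "\<forall>d\<in>insert x F. (x, d) \<in> r"
      using transD[OF tr] by blast
    then show ?thesis by blast
  qed
qed

text \<open>The definite description denotes: finiteness yields a minimiser and a least one among
  them, antisymmetry its uniqueness.\<close>

lemma removed_candidate_in_min_loss_candidates: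
  assumes "linear_order r" "finite S" "S \<noteq> {}"
  shows "removed_candidate r E S \<in> min_loss_candidates E S"
proof -
  let ?M = "min_loss_candidates E S"
  have sub: "?M \<subseteq> S"
    by (auto simp: min_loss_candidates_def is_arg_min_def)
  have "\<exists>c. is_arg_min (marginal_loss E S) (\<lambda>c. c \<in> S) c"
    using ex_is_arg_min_if_finite[OF assms(2,3)] .
  then have "?M \<noteq> {}"
    by (auto simp: min_loss_candidates_def)
  then obtain c where c: "c \<in> ?M" "\<forall>d\<in>?M. (c, d) \<in> r"
    using linear_order_finite_has_least[OF assms(1)] sub assms(2) finite_subset by metis
  have "removed_candidate r E S = c"
    unfolding removed_candidate_def
  proof (rule the_equality)
    fix c' assume "c' \<in> ?M \<and> (\<forall>d\<in>?M. (c', d) \<in> r)"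
    then show "c' = c"
      using c assms(1) by (auto simp: order_on_defs dest: antisymD)
  qed (use c in blast)
  with c show ?thesis by simp
qed

lemma removed_candidate_in:
  assumes "linear_order r" "finite S" "S \<noteq> {}"
  shows "removed_candidate r E S \<in> S"
  using removed_candidate_in_min_loss_candidates[OF assms]
  by (auto simp: min_loss_candidates_def is_arg_min_def)

text \<open>A strict inequality excludes \<open>y\<close> under any priority order; hence all later
  comparisons of losses are strict.\<close>

lemma removed_candidate_neqI:
  assumes "linear_order r" "finite S" "x \<in> S" "marginal_loss E S x < marginal_loss E S y"
  shows "removed_candidate r E S \<noteq> y"
  using removed_candidate_in_min_loss_candidates[OF assms(1,2), of E] assms(3,4)
  by (auto simp: min_loss_candidates_def is_arg_min_def)

text \<open>Removing \<open>c\<close> shrinks \<open>ballot E i \<inter> S\<close> by one exactly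
  for the voters approving \<open>c\<close>, and H(t) - H(t - 1) = 1/t.\<close>

lemma marginal_loss_eq:
  assumes "finite S" "c \<in> S"
  shows "marginal_loss E S c =
    (\<Sum>i\<in>voters E. if c \<in> ballot E i then 1 / real (card (ballot E i \<inter> S)) else 0)"
  unfolding marginal_loss_def PAV_def sum_subtractf[symmetric]
proof (rule sum.cong[OF refl])
  fix i
  let ?A = "ballot E i"
  show "harm (card (?A \<inter> S)) - harm (card (?A \<inter> (S - {c}))) =
    (if c \<in> ?A then 1 / real (card (?A \<inter> S)) else 0)"
  proof (cases "c \<in> ?A")
    case True
    have "?A \<inter> S = insert c (?A \<inter> (S - {c}))"
      using True assms by auto
    then have "card (?A \<inter> S) = Suc (card (?A \<inter> (S - {c})))"
      using assms(1) by (metis Diff_iff Int_iff card_insert_disjoint finite_Diff finite_Int insertI1)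
    then show ?thesis
      using True by (simp add: harm_Suc inverse_eq_divide)
  next
    case False
    then have "?A \<inter> (S - {c}) = ?A \<inter> S" by auto
    with False show ?thesis by simp
  qed
qed

section \<open>The election and its blocks of candidates\<close>

locale starved_group =
  fixes e :: "nat \<Rightarrow> 'c" and r :: "'c rel" and l :: nat
  assumes inj_e: "inj e" and lin: "linear_order r" and l_pos: "l \<ge> 1"
begin

text \<open>Cohesiveness requires l (B + B^2 + 2k) \<le> B k. With B = 4l this amounts to k \<ge> 2l
  + 8l^2, which k = 10l^2 satisfies for l \<ge> 1.\<close>

definition B :: nat where "B = 4 * l"
definition k :: nat where "k = 10 * l\<^sup>2"

definition X :: "nat \<Rightarrow> 'c set" where "X i = e ` {k * i..<k * Suc i}"
definition U :: "'c set" where "U = e ` {..<k * Suc B}"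
definition C :: "'c set" where "C = e ` {k * Suc B..<k * Suc B + l}"

text \<open>Each residue modulo \<open>k\<close> occurs twice among \<open>2 * k\<close> consecutive
  indices, so \<open>i mod k\<close> assigns two single-candidate voters to every member of
  \<open>X 0\<close>, wherever the index range starts.\<close>

definition E :: "'c election" where
  "E = \<lparr>num_voters = B + B\<^sup>2 + 2 * k, candidates = U \<union> C,
        ballot = (\<lambda>i. if i \<le> B then C \<union> X i else if i \<le> B + B\<^sup>2 then U else {e (i mod k)}),
        committee_size = k\<rparr>"

lemma k_pos: "k > 0" and B_pos: "B > 0"
  using l_pos by (auto simp: k_def B_def)

lemma card_X: "card (X i) = k" and finite_X: "finite (X i)"
  unfolding X_def by (auto simp: card_image inj_on_subset[OF inj_e])

lemma card_U: "card U = k * Suc B" and finite_U: "finite U"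
  unfolding U_def by (auto simp: card_image inj_on_subset[OF inj_e])

lemma card_C: "card C = l" and finite_C: "finite C"
  unfolding C_def by (auto simp: card_image inj_on_subset[OF inj_e])

text \<open>Division by \<open>k\<close> reads off the block of a candidate; disjointness of the
  blocks and the decomposition of \<open>U\<close> both follow from this.\<close>

lemma mem_X_iff: "e m \<in> X i \<longleftrightarrow> m div k = i"
proof -
  have "e m \<in> X i \<longleftrightarrow> k * i \<le> m \<and> m < k * Suc i"
    unfolding X_def by (auto simp: inj_eq[OF inj_e])
  also have "\<dots> \<longleftrightarrow> m div k = i"
    using k_pos by (metis div_nat_eqI dividend_less_times_div mult.commute mult_Suc_right
        times_div_less_eq_dividend add.commute)
  finally show ?thesis .
qed

lemma X_disjoint: "c \<in> X i \<Longrightarrow> c \<in> X j \<Longrightarrow> i = j"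
  by (metis X_def imageE mem_X_iff)

lemma U_eq: "U = (\<Union>i\<le>B. X i)"
proof -
  have "e m \<in> U \<longleftrightarrow> m div k \<le> B" for m
  proof -
    have "e m \<in> U \<longleftrightarrow> m < Suc B * k"
      unfolding U_def by (auto simp: inj_eq[OF inj_e] mult.commute)
    also have "\<dots> \<longleftrightarrow> m div k \<le> B"
      using k_pos by (simp add: less_Suc_eq_le[symmetric] div_less_iff_less_mult del: mult_Suc)
    finally show ?thesis .
  qed
  moreover have "U \<subseteq> range e" "X i \<subseteq> range e" for i
    by (auto simp: U_def X_def)
  ultimately have "c \<in> U \<longleftrightarrow> (\<exists>i\<le>B. c \<in> X i)" for c
    by (metis mem_X_iff rangeE subsetD)
  then show ?thesis by blast
qed

lemma C_U_disjoint: "C \<inter> U = {}"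
  unfolding C_def U_def by (auto simp: inj_eq[OF inj_e])

lemma C_X_disjoint: "i \<le> B \<Longrightarrow> C \<inter> X i = {}"
  using C_U_disjoint U_eq by blast

lemma E_sel [simp]:
  "candidates E = U \<union> C" "committee_size E = k" "num_voters E = B + B\<^sup>2 + 2 * k"
  "i \<le> B \<Longrightarrow> ballot E i = C \<union> X i"
  "B < i \<Longrightarrow> i \<le> B + B\<^sup>2 \<Longrightarrow> ballot E i = U"
  "B + B\<^sup>2 < i \<Longrightarrow> ballot E i = {e (i mod k)}"
  by (simp_all add: E_def)

lemma voters_E:
  "voters E = {1..B} \<union> ({B + 1..B + B\<^sup>2} \<union> {B + B\<^sup>2 + 1..B + B\<^sup>2 + 2 * k})"
  by (auto simp: voters_def)

section \<open>Marginal losses in the constructed election\<close>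

lemma marginal_loss_split:
  assumes "finite S" "c \<in> S"
  shows "marginal_loss E S c =
    (\<Sum>i=1..B. if c \<in> C \<union> X i then 1 / real (card ((C \<union> X i) \<inter> S)) else 0)
    + (if c \<in> U then real (B\<^sup>2) / real (card (U \<inter> S)) else 0)
    + real (card {i\<in>{B + B\<^sup>2 + 1..B + B\<^sup>2 + 2 * k}. c = e (i mod k)})"
proof -
  let ?g = "\<lambda>i. if c \<in> ballot E i then 1 / real (card (ballot E i \<inter> S)) else 0"
  let ?P = "{B + B\<^sup>2 + 1..B + B\<^sup>2 + 2 * k}"
  have "marginal_loss E S c = sum ?g {1..B} + (sum ?g {B + 1..B + B\<^sup>2} + sum ?g ?P)"
    unfolding marginal_loss_eq[OF assms] voters_E
    by (subst sum.union_disjoint; auto)+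
  moreover have "sum ?g {1..B} =
      (\<Sum>i=1..B. if c \<in> C \<union> X i then 1 / real (card ((C \<union> X i) \<inter> S)) else 0)"
    by (rule sum.cong) auto
  moreover have "sum ?g {B + 1..B + B\<^sup>2} =
      (\<Sum>i=B + 1..B + B\<^sup>2. if c \<in> U then 1 / real (card (U \<inter> S)) else 0)"
    by (rule sum.cong) auto
  \<comment> \<open>Since \<open>c \<in> S\<close>, a ballot \<open>{c}\<close> meets
    \<open>S\<close> in exactly one candidate, so such a voter contributes 1.\<close>
  moreover have "sum ?g ?P = (\<Sum>i\<in>?P. if c = e (i mod k) then 1 else 0)"
    using assms(2) by (intro sum.cong) auto
  moreover have "\<dots> = real (card {i\<in>?P. c = e (i mod k)})"
    by (simp add: sum.If_cases Int_def)
  ultimately show ?thesis by simp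
qed

lemma no_singleton_ballot:
  assumes "c \<notin> X 0"
  shows "{i\<in>A. c = e (i mod k)} = {}"
  using assms k_pos by (auto simp: mem_X_iff)

lemma marginal_loss_X:
  assumes "finite S" "x \<in> S" "x \<in> X j" "1 \<le> j" "j \<le> B"
  shows "marginal_loss E S x =
    1 / real (card ((C \<union> X j) \<inter> S)) + real (B\<^sup>2) / real (card (U \<inter> S))"
proof -
  have U: "x \<in> U" using assms by (auto simp: U_eq)
  then have "x \<notin> C" using C_U_disjoint by blast
  moreover have "x \<in> X i \<longleftrightarrow> i = j" for i
    using assms(3) X_disjoint by blast
  ultimately have "(\<Sum>i=1..B. if x \<in> C \<union> X i then 1 / real (card ((C \<union> X i) \<inter> S)) else 0)
      = (\<Sum>i=1..B. if i = j then 1 / real (card ((C \<union> X j) \<inter> S)) else 0)"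
    by (intro sum.cong) auto
  also have "\<dots> = 1 / real (card ((C \<union> X j) \<inter> S))"
    using assms by simp
  finally have 1: "(\<Sum>i=1..B. if x \<in> C \<union> X i then 1 / real (card ((C \<union> X i) \<inter> S)) else 0)
      = 1 / real (card ((C \<union> X j) \<inter> S))" .
  have "x \<notin> X 0" using assms X_disjoint by fastforce
  then show ?thesis
    unfolding marginal_loss_split[OF assms(1,2)] 1 no_singleton_ballot[OF \<open>x \<notin> X 0\<close>]
    using U by simp
qed

lemma marginal_loss_X0:
  assumes "finite S" "f \<in> S" "f \<in> X 0"
  shows "marginal_loss E S f \<ge> 2 + real (B\<^sup>2) / real (card (U \<inter> S))"
proof -
  have U: "f \<in> U" using assms by (auto simp: U_eq)
  obtain m where m: "f = e m" "m < k"
    using assms(3) by (auto simp: X_def)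
  let ?q = "B + B\<^sup>2"
  let ?P = "{i\<in>{?q + 1..?q + 2 * k}. f = e (i mod k)}"
  \<comment> \<open>the two numbers congruent to \<open>m\<close> modulo \<open>k\<close> in an interval of length \<open>2 k\<close>\<close>
  define d where "d = (m + k - (?q + 1) mod k) mod k"
  have d: "d < k" using k_pos by (simp add: d_def)
  have "(?q + 1 + d) mod k = ((?q + 1) mod k + (m + k - (?q + 1) mod k)) mod k"
    unfolding d_def by (metis mod_add_eq mod_mod_trivial)
  also have "(?q + 1) mod k + (m + k - (?q + 1) mod k) = m + k"
    using mod_less_divisor[OF k_pos, of "?q + 1"] by linarith
  finally have d_mod: "(?q + 1 + d) mod k = m"
    using m by simp
  define j where "j = ?q + 1 + d"
  have "j mod k = m" "(j + k) mod k = m"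
    using d_mod unfolding j_def by (simp_all only: mod_add_self2)
  moreover have "?q + 1 \<le> j" "j + k \<le> ?q + 2 * k"
    using d by (simp_all add: j_def)
  ultimately have "{j, j + k} \<subseteq> ?P"
    using m by auto
  then have "card {j, j + k} \<le> card ?P"
    by (intro card_mono) auto
  then have "card ?P \<ge> 2"
    using k_pos by simp
  moreover have "(\<Sum>i=1..B. if f \<in> C \<union> X i then 1 / real (card ((C \<union> X i) \<inter> S)) else 0) \<ge> 0"
    by (intro sum_nonneg) auto
  ultimately show ?thesis
    unfolding marginal_loss_split[OF assms(1,2)] using U by simp
qed

lemma marginal_loss_X_less_X0:
  assumes "finite S" "x \<in> S" "x \<in> X j" "1 \<le> j" "j \<le> B" "f \<in> S" "f \<in> X 0"
  shows "marginal_loss E S x < marginal_loss E S f"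
proof -
  \<comment> \<open>The case \<open>n = 0\<close> holds because division by zero gives 0, so the
    intersection need not be shown non-empty.\<close>
  have "(1::real) / real n \<le> 1" for n by (cases n) auto
  then have "1 / real (card ((C \<union> X j) \<inter> S)) \<le> 1" .
  then show ?thesis
    using marginal_loss_X[OF assms(1-5)] marginal_loss_X0[OF assms(1,6,7)] by linarith
qed

text \<open>With \<open>U\<close> intact, every ballot of the first kind meets \<open>S\<close> in
  \<open>q + k\<close> candidates, where \<open>q\<close> counts the survivors of \<open>C\<close>.
  All \<open>B\<close> of these voters approve \<open>c\<close>, only one of them approves
  \<open>x\<close>, and the voters of the second kind outweigh the difference.\<close>

lemma marginal_loss_C_less_X:
  assumes "finite S" "c \<in> S" "c \<in> C" "U \<subseteq> S" "x \<in> X j" "1 \<le> j" "j \<le> B"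
  shows "marginal_loss E S c < marginal_loss E S x"
proof -
  have "x \<in> U" using assms by (auto simp: U_eq)
  then have xS: "x \<in> S" using assms by blast
  have cU: "c \<notin> U" using assms C_U_disjoint by blast
  then have cX: "c \<notin> X 0" by (auto simp: U_eq)
  define q where "q = card (C \<inter> S)"
  have q: "q \<ge> 1"
    using assms finite_C by (auto simp: q_def Suc_le_eq card_gt_0_iff)
  have card_q: "card ((C \<union> X i) \<inter> S) = q + k" if "1 \<le> i" "i \<le> B" for i
  proof -
    have "(C \<union> X i) \<inter> S = (C \<inter> S) \<union> X i"
      using assms(4) that by (auto simp: U_eq)
    moreover have "card ((C \<inter> S) \<union> X i) = q + k"
      unfolding q_def using C_X_disjoint[OF that(2)] finite_C finite_X
      by (subst card_Un_disjoint) (auto simp: card_X)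
    ultimately show ?thesis by simp
  qed
  have "(\<Sum>i=1..B. if c \<in> C \<union> X i then 1 / real (card ((C \<union> X i) \<inter> S)) else 0)
      = (\<Sum>i=1..B. 1 / real (q + k))"
    using assms(3) card_q by (intro sum.cong) auto
  then have c_eq: "marginal_loss E S c = real B / real (q + k)"
    unfolding marginal_loss_split[OF assms(1,2)] no_singleton_ballot[OF cX]
    using cU by simp
  have "U \<inter> S = U" using assms by blast
  then have x_eq: "marginal_loss E S x = 1 / real (q + k) + real (B\<^sup>2) / real (k * Suc B)"
    using marginal_loss_X[OF assms(1) xS assms(5-7)] card_q[OF assms(6,7)] card_U by simp
  \<comment> \<open>Cancelling the one first-kind voter who approves \<open>x\<close> leaves
    \<open>B - 1\<close>; the worst case is \<open>q = 1\<close>, the last survivor of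
    \<open>C\<close>.\<close>
  have "(real B - 1) / real (q + k) \<le> (real B - 1) / real (1 + k)"
    using B_pos q k_pos by (intro divide_left_mono) auto
  also have "\<dots> < real (B\<^sup>2) / real (k * Suc B)"
  proof -
    \<comment> \<open>Cross-multiplied, the claim is k (B^2 - 1) < B^2 (1 + k).\<close>
    have "(real B - 1) * real (k * Suc B) = real k * ((real B)\<^sup>2 - 1)"
      by (simp add: algebra_simps power2_eq_square)
    also have "\<dots> < real (B\<^sup>2) * real (1 + k)"
      using k_pos B_pos by (simp add: algebra_simps add_pos_pos)
    finally show ?thesis
      using k_pos by (simp add: divide_simps mult.commute del: of_nat_Suc of_nat_mult of_nat_add)
  qed
  finally show ?thesis
    unfolding c_eq x_eq by (simp add: diff_divide_distrib)
qed

section \<open>The course of the removals\<close>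

definition remove :: "'c set \<Rightarrow> 'c set" where
  "remove S = S - {removed_candidate r E S}"

text \<open>An invariant for both phases: the implication forces \<open>C\<close> to be exhausted
  before any block is touched, and \<open>X 0\<close> is preserved throughout.\<close>

definition safe :: "'c set \<Rightarrow> bool" where
  "safe S \<longleftrightarrow> X 0 \<subseteq> S \<and> S \<subseteq> U \<union> C \<and> (C \<inter> S \<noteq> {} \<longrightarrow> U \<subseteq> S)"

lemma safe_remove:
  assumes "safe S" "S \<noteq> X 0"
  shows "safe (remove S)" "card (remove S) = card S - 1"
proof -
  have fin: "finite S"
    using assms finite_U finite_C by (auto simp: safe_def intro: finite_subset)
  have "S \<noteq> {}" using assms by (auto simp: safe_def)
  define d where "d = removed_candidate r E S"
  have d: "d \<in> S"
    unfolding d_def using removed_candidate_in[OF lin fin \<open>S \<noteq> {}\<close>] .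
  then show "card (remove S) = card S - 1"
    using fin by (simp add: remove_def d_def)
  have neq: "d \<noteq> y" if "x \<in> S" "marginal_loss E S x < marginal_loss E S y" for x y
    unfolding d_def using removed_candidate_neqI[OF lin fin that] .
  \<comment> \<open>A candidate cheaper than every member of \<open>X 0\<close>. If \<open>C\<close>
    is exhausted, it exists because \<open>S\<close> lies in \<open>U\<close> and properly contains
    \<open>X 0\<close>; otherwise all of \<open>X 1\<close> is still present.\<close>
  have X1: "\<exists>x\<in>S. \<exists>j. x \<in> X j \<and> 1 \<le> j \<and> j \<le> B"
  proof (cases "C \<inter> S = {}")
    case True
    then obtain x where "x \<in> S" "x \<in> U" "x \<notin> X 0"
      using assms by (auto simp: safe_def)
    moreover then obtain j where "x \<in> X j" "j \<le> B"
      by (auto simp: U_eq)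
    ultimately show ?thesis by (cases j) auto
  next
    case False
    then have "U \<subseteq> S" using assms(1) by (simp add: safe_def)
    moreover obtain x where x: "x \<in> X 1"
      using card_X[of 1] k_pos by fastforce
    moreover have B1: "1 \<le> B" using B_pos by simp
    moreover have "x \<in> U" using x B1 by (auto simp: U_eq)
    ultimately show ?thesis by blast
  qed
  then have dX0: "d \<notin> X 0"
    using neq marginal_loss_X_less_X0[OF fin] d by blast
  \<comment> \<open>The block \<open>X 0\<close> is already excluded, so comparing \<open>C\<close>
    with the blocks of positive index suffices.\<close>
  moreover have "d \<in> C" if ne: "C \<inter> S \<noteq> {}"
  proof (rule ccontr)
    assume "d \<notin> C"
    then have "d \<in> U" using d assms(1) by (auto simp: safe_def)
    then obtain j where j: "d \<in> X j" "j \<le> B" by (auto simp: U_eq)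
    with dX0 have "1 \<le> j" by (cases j) auto
    obtain c where c: "c \<in> S" "c \<in> C" using ne by blast
    have "U \<subseteq> S" using ne assms(1) by (simp add: safe_def)
    from neq[OF c(1) marginal_loss_C_less_X[OF fin c this j(1) \<open>1 \<le> j\<close> j(2)]]
    show False by simp
  qed
  ultimately show "safe (remove S)"
    using assms(1) C_U_disjoint unfolding safe_def remove_def d_def by blast
qed

lemma card_candidates: "card (candidates E) = k * Suc B + l"
  using card_Un_disjoint[OF finite_U finite_C] C_U_disjoint
  by (simp add: card_U card_C Int_commute)

text \<open>The bound on \<open>t\<close> is the total number of rounds. Before each of them more
  than \<open>k\<close> candidates remain, so the set differs from \<open>X 0\<close> and
  \<open>safe_remove\<close> applies.\<close>

lemma safe_funpow:
  assumes "t \<le> k * B + l"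
  shows "safe ((remove ^^ t) (U \<union> C)) \<and>
    card ((remove ^^ t) (U \<union> C)) = k * Suc B + l - t"
  using assms
proof (induction t)
  case 0
  then show ?case
    using card_candidates by (auto simp: safe_def U_eq)
next
  case (Suc t)
  let ?S = "(remove ^^ t) (U \<union> C)"
  have S: "safe ?S" "card ?S = k * Suc B + l - t" using Suc by auto
  then have "card ?S > card (X 0)" using Suc.prems by (simp add: card_X)
  then have "?S \<noteq> X 0" by auto
  then show ?case using safe_remove[OF S(1)] S(2) by simp
qed

text \<open>The final set is safe, hence contains \<open>X 0\<close>, and both sets have
  \<open>k\<close> elements.\<close>

lemma RevSeqPAV_E: "RevSeqPAV r E = X 0"
proof -
  have rounds: "card (candidates E) - committee_size E = k * B + l"
    unfolding card_candidates by simp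
  have "RevSeqPAV r E = (remove ^^ (k * B + l)) (U \<union> C)"
    unfolding RevSeqPAV_def rounds by (simp add: remove_def[abs_def])
  then have W: "safe (RevSeqPAV r E)" "card (RevSeqPAV r E) = k"
    using safe_funpow[of "k * B + l"] by simp_all
  then have "finite (RevSeqPAV r E)"
    using k_pos by (auto intro: card_ge_0_finite)
  then show ?thesis
    using W card_subset_eq[of "RevSeqPAV r E" "X 0"] card_X by (auto simp: safe_def)
qed

section \<open>Validity, the cohesive group and its satisfaction\<close>

lemma valid_E: "valid_election E"
proof -
  have "finite (candidates E)" using finite_U finite_C by simp
  moreover have "ballot E i \<subseteq> candidates E" if "i \<in> voters E" for i
    using that unfolding voters_E
  proof (elim UnE)
    assume "i \<in> {B + B\<^sup>2 + 1..B + B\<^sup>2 + 2 * k}"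
    moreover have "e (i mod k) \<in> X 0" using k_pos by (simp add: mem_X_iff)
    ultimately show ?thesis by (auto simp: U_eq)
  qed (auto simp: U_eq)
  moreover have "committee_size E < card (candidates E)"
    unfolding card_candidates using l_pos by simp
  moreover have "1 \<in> voters E" "ballot E 1 \<noteq> {}"
    using B_pos card_C l_pos by (auto simp: voters_E)
  moreover have "1 \<le> committee_size E" using k_pos by simp
  ultimately show ?thesis unfolding valid_election_def by blast
qed

lemma cohesive_E: "cohesive E l {1..B}"
  unfolding cohesive_def
proof (intro conjI)
  show "{1..B} \<subseteq> voters E" by (auto simp: voters_E)
  \<comment> \<open>The size condition with denominators cleared; it reduces to l^2 \<le>
    l^3.\<close>
  have "l * (B + B\<^sup>2 + 2 * k) \<le> B * k"
  proof -
    have "l * (B + B\<^sup>2 + 2 * k) = 4 * l ^ 2 + 36 * l ^ 3"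
      by (simp add: B_def k_def algebra_simps power2_eq_square power3_eq_cube)
    moreover have "B * k = 40 * l ^ 3"
      by (simp add: B_def k_def power2_eq_square power3_eq_cube)
    moreover have "l ^ 2 \<le> l ^ 3"
      using l_pos by (intro power_increasing) auto
    ultimately show ?thesis by linarith
  qed
  then have "real l * real (B + B\<^sup>2 + 2 * k) \<le> real B * real k"
    by (metis of_nat_le_iff of_nat_mult)
  then show "real l * real (num_voters E) / real (committee_size E) \<le> real (card {1..B})"
    using k_pos by (simp add: pos_divide_le_eq)
  have "C \<subseteq> (\<Inter>i\<in>{1..B}. ballot E i)" by auto
  \<comment> \<open>An infinite set has \<open>card\<close> 0, so the lower bound on the cardinality
    needs a finite superset of the intersection.\<close>
  moreover have "(\<Inter>i\<in>{1..B}. ballot E i) \<subseteq> C \<union> X 1"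
    using B_pos by (fastforce simp: Suc_le_eq)
  then have "finite (\<Inter>i\<in>{1..B}. ballot E i)"
    using finite_C finite_X by (meson finite_UnI finite_subset)
  ultimately show "l \<le> card (\<Inter>i\<in>{1..B}. ballot E i)"
    using card_mono card_C by metis
qed

lemma avg_satisfaction_E: "avg_satisfaction E {1..B} (RevSeqPAV r E) = 0"
proof -
  have "ballot E i \<inter> X 0 = {}" if "i \<in> {1..B}" for i
    using that C_X_disjoint[of 0] X_disjoint[of _ i 0] by fastforce
  then show ?thesis
    unfolding avg_satisfaction_def RevSeqPAV_E by simp
qed

end

theorem theorem5:
  fixes r :: "'c rel" and l :: nat
  assumes "infinite (UNIV :: 'c set)"
    and "linear_order r"
    and "l \<ge> 1"
  shows "is_proportionality_degree (RevSeqPAV r) l 0"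
proof -
  \<comment> \<open>A copy of the naturals inside the candidate type supplies the candidates for any
    \<open>l\<close>.\<close>
  obtain e :: "nat \<Rightarrow> 'c" where "inj e"
    using infinite_countable_subset[OF assms(1)] by blast
  with assms interpret starved_group e r l
    by unfold_locales
  \<comment> \<open>Any guarantee \<open>d\<close> applies to the starved group, whose average is 0;
    conversely, averages of cardinalities are never negative.\<close>
  have "d \<le> 0" if "proportionality_degree_at_least (RevSeqPAV r) l d" for d
    using that valid_E cohesive_E avg_satisfaction_E
    unfolding proportionality_degree_at_least_def by metis
  moreover have "proportionality_degree_at_least (RevSeqPAV r) l 0"
    unfolding proportionality_degree_at_least_def avg_satisfaction_def
    by (auto intro!: divide_nonneg_nonneg sum_nonneg)
  ultimately show ?thesis
    unfolding is_proportionality_degree_def by blast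
qed

end
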